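(* For all integers $n\ge 1$ and $k\ge 1$ there is an explicit bijection between the set of Dyck paths of length $2n$ and height at most $2$ with $k$ returns to zero and the set of integer compositions of $n$ with $k$ parts.
   Context: A Dyck path of length $2n$ is a lattice path from $(0,0)$ to $(2n,0)$ with steps $\mathtt{u}=(1,1)$ and $\mathtt{d}=(1,-1)$ that never goes below the $x$-axis. Its height is the maximal ordinate it reaches. A return to zero is a $\mathtt{d}$ step ending on the $x$-axis (the final step of a non-empty Dyck path is thus counted as a return). An integer composition of $n$ with $k$ parts is a sequence of $k$ positive integers with sum $n$. *)

theory Defs
  imports Main "HOL-Library.Product_Plus"
begin

datatype step = U | D

fun step_vec :: "step \<Rightarrow> int \<times> int" where
  "step_vec U = (1, 1)"
| "step_vec D = (1, -1)"

text \<open>The lattice point reached after the first \<open>i\<close> steps, starting from \<open>(0, 0)\<close>.\<close>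

definition vertex :: "step list \<Rightarrow> nat \<Rightarrow> int \<times> int" where
  "vertex p i = sum_list (map step_vec (take i p))"

text \<open>A path is the list of its steps; \<open>dyck_paths n\<close> are the Dyck paths of length \<open>2 * n\<close>.\<close>

definition dyck_paths :: "nat \<Rightarrow> step list set" where
  "dyck_paths n = {p. vertex p (length p) = (2 * int n, 0) \<and>
                      (\<forall>i\<le>length p. 0 \<le> snd (vertex p i))}"

definition height :: "step list \<Rightarrow> int" where
  "height p = Max ((\<lambda>i. snd (vertex p i)) ` {..length p})"

text \<open>The abscissae, in increasing order, of the endpoints of the returns to zero.
  The step ending at abscissa \<open>x\<close> is \<open>p ! (x - 1)\<close>.\<close>

definition returns :: "step list \<Rightarrow> nat list" where
  "returns p = filter (\<lambda>x. p ! (x - 1) = D \<and> snd (vertex p x) = 0) [1..<Suc (length p)]"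

definition compositions :: "nat \<Rightarrow> nat \<Rightarrow> nat list set" where
  "compositions n k = {c. length c = k \<and> (\<forall>a\<in>set c. 0 < a) \<and> sum_list c = n}"

text \<open>The explicit bijection: if the returns to zero end at abscissae \<open>x\<^sub>1 < \<dots> < x\<^sub>k\<close>, then
  with \<open>x\<^sub>0 = 0\<close> the composition has parts \<open>(x\<^sub>i - x\<^sub>i\<^sub>-\<^sub>1) / 2\<close>, the semilengths of the
  factors of the path between consecutive visits to the axis.\<close>

definition return_composition :: "step list \<Rightarrow> nat list" where
  "return_composition p = map2 (\<lambda>x y. (y - x) div 2) (0 # returns p) (returns p)"

end

theory Submission
  imports Defs
begin

text \<open>A Dyck path of height at most 2 is a concatenation of factors that touch the axis only at
  their two ends, and such a factor of semilength \<open>m\<close> and height at most 2 is forced to be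
  \<open>U (U D)\<^sup>m\<^sup>-\<^sup>1 D\<close>. So the path is determined by the semilengths of its factors, which can be
  prescribed arbitrarily.\<close>

definition zigzag :: "nat \<Rightarrow> step list" where
  "zigzag m = concat (replicate m [U, D])"

text \<open>Truncated subtraction makes \<open>factor 0\<close> equal to \<open>factor 1\<close>, so
  facts about the length \<open>2 * m\<close> assume \<open>0 < m\<close>.\<close>

definition factor :: "nat \<Rightarrow> step list" where
  "factor m = U # zigzag (m - 1) @ [D]"

definition path_of :: "nat list \<Rightarrow> step list" where
  "path_of c = concat (map factor c)"

text \<open>Letter-by-letter form of staying between 0 and 2 and ending on the axis. Each step tests
  only the bound it could break; the starting height is untested, whence the assumptions of
  \<open>strip_iff\<close>.\<close>

fun strip :: "int \<Rightarrow> step list \<Rightarrow> bool" where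
  "strip h [] \<longleftrightarrow> h = 0"
| "strip h (U # p) \<longleftrightarrow> h + 1 \<le> 2 \<and> strip (h + 1) p"
| "strip h (D # p) \<longleftrightarrow> 0 \<le> h - 1 \<and> strip (h - 1) p"

section \<open>Vertices and the height bound\<close>

lemma vertex_0 [simp]: "vertex p 0 = 0"
  by (simp add: vertex_def)

lemma vertex_Cons_Suc [simp]: "vertex (s # p) (Suc i) = step_vec s + vertex p i"
  by (simp add: vertex_def)

lemma vertex_append: "vertex (p @ q) i = vertex p i + vertex q (i - length p)"
  by (simp add: vertex_def)

lemma vertex_beyond: "length p \<le> i \<Longrightarrow> vertex p i = vertex p (length p)"
  by (simp add: vertex_def)

lemma fst_step_vec [simp]: "fst (step_vec s) = 1"
  by (cases s) auto

lemma fst_vertex_length: "fst (vertex p (length p)) = int (length p)"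
  by (induction p) auto

lemma all_atMost_Suc: "(\<forall>i\<le>Suc n. P i) \<longleftrightarrow> P 0 \<and> (\<forall>i\<le>n. P (Suc i))"
  by (metis Suc_le_mono not0_implies_Suc zero_le)

lemma strip_iff:
  assumes "0 \<le> h" "h \<le> 2"
  shows "strip h p \<longleftrightarrow> h + snd (vertex p (length p)) = 0 \<and>
           (\<forall>i\<le>length p. 0 \<le> h + snd (vertex p i) \<and> h + snd (vertex p i) \<le> 2)"
  using assms
proof (induction h p rule: strip.induct)
  case (2 h p)
  then show ?case
    by (cases "h + 1 \<le> 2") (auto simp: all_atMost_Suc add.assoc dest: spec[of _ 0])
next
  case (3 h p)
  then show ?case
    by (cases "0 \<le> h - 1") (auto simp: all_atMost_Suc add_diff_eq diff_add_eq dest: spec[of _ 0])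
qed auto

lemma dyck_path_height_le_2_iff:
  "p \<in> dyck_paths n \<and> height p \<le> 2 \<longleftrightarrow> length p = 2 * n \<and> strip 0 p"
proof -
  have "height p \<le> 2 \<longleftrightarrow> (\<forall>i\<le>length p. snd (vertex p i) \<le> 2)"
    by (auto simp: height_def)
  \<comment> \<open>Every step advances the abscissa by 1, so an endpoint with abscissa
    \<open>2 * n\<close> means length \<open>2 * n\<close>.\<close>
  moreover have "p \<in> dyck_paths n \<longleftrightarrow> length p = 2 * n \<and> snd (vertex p (length p)) = 0 \<and>
      (\<forall>i\<le>length p. 0 \<le> snd (vertex p i))"
    using fst_vertex_length[of p] by (auto simp: dyck_paths_def prod_eq_iff)
  ultimately show ?thesis
    by (auto simp: strip_iff)
qed

section \<open>Heights along zigzags and factors\<close>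

lemma zigzag_0 [simp]: "zigzag 0 = []"
  by (simp add: zigzag_def)

lemma zigzag_Suc [simp]: "zigzag (Suc m) = U # D # zigzag m"
  by (simp add: zigzag_def)

lemma length_zigzag [simp]: "length (zigzag m) = 2 * m"
  by (induction m) auto

lemma vertex_zigzag_nonneg: "0 \<le> snd (vertex (zigzag m) i)"
proof (induction m arbitrary: i)
  case 0
  then show ?case by (simp add: vertex_def)
next
  case (Suc m)
  show ?case
  proof (cases i)
    case (Suc j)
    then show ?thesis using Suc.IH[of "j - 1"] by (cases j) auto
  qed simp
qed

lemma vertex_zigzag_end: "snd (vertex (zigzag m) (2 * m)) = 0"
  by (induction m) auto

lemma length_factor: "0 < m \<Longrightarrow> length (factor m) = 2 * m"
  by (cases m) (auto simp: factor_def)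

lemma vertex_factor_end: "snd (vertex (factor m) (length (factor m))) = 0"
  \<comment> \<open>Splitting off the final \<open>D\<close> with \<open>vertex_append\<close> reads
    the zigzag one index past its end, where \<open>vertex\<close> stays constant.\<close>
  using vertex_beyond[of "zigzag (m - 1)" "Suc (2 * (m - 1))"]
  by (simp add: factor_def vertex_append vertex_zigzag_end)

text \<open>Strictly between its ends, a factor is a zigzag lifted by the initial
  \<open>U\<close>.\<close>

lemma vertex_factor_pos:
  assumes "0 < i" "i < length (factor m)"
  shows "0 < snd (vertex (factor m) i)"
proof -
  obtain j where "i = Suc j" "j \<le> 2 * (m - 1)"
    using assms by (cases i) (auto simp: factor_def)
  then show ?thesis
    using vertex_zigzag_nonneg[of "m - 1" j] by (simp add: factor_def vertex_append)
qed

section \<open>Returns to zero of concatenations\<close>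

lemma returns_factor:
  assumes "0 < m"
  shows "returns (factor m) = [2 * m]"
proof -
  let ?P = "\<lambda>x. factor m ! (x - 1) = D \<and> snd (vertex (factor m) x) = 0"
  have "filter ?P [1..<2 * m] = []"
    unfolding filter_empty_conv
  proof
    fix x assume "x \<in> set [1..<2 * m]"
    then have "0 < snd (vertex (factor m) x)"
      using assms by (intro vertex_factor_pos) (auto simp: length_factor)
    then show "\<not> ?P x" by simp
  qed
  moreover have "?P (2 * m)"
  proof
    show "factor m ! (2 * m - 1) = D"
      using assms by (cases m) (auto simp: factor_def nth_append)
    show "snd (vertex (factor m) (2 * m)) = 0"
      using vertex_factor_end[of m] assms by (simp add: length_factor)
  qed
  ultimately show ?thesis
    using assms by (simp add: returns_def length_factor)
qed

text \<open>Since \<open>p\<close> ends on the axis, appending \<open>q\<close> to it shifts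
  abscissae but leaves the heights of \<open>q\<close> unchanged.\<close>

lemma returns_append:
  assumes "snd (vertex p (length p)) = 0"
  shows "returns (p @ q) = returns p @ map (\<lambda>x. x + length p) (returns q)"
proof -
  let ?P = "\<lambda>p x. p ! (x - 1) = D \<and> snd (vertex p x) = 0"
  have split: "[1..<Suc (length (p @ q))] =
      [1..<Suc (length p)] @ map (\<lambda>x. x + length p) [1..<Suc (length q)]"
    by (rule nth_equalityI) (auto simp: nth_append simp del: upt_Suc)
  \<comment> \<open>Both ranges start at 1, so the step at \<open>x - 1\<close> lies in the same
    block as the endpoint \<open>x\<close>.\<close>
  have left: "filter (?P (p @ q)) [1..<Suc (length p)] = filter (?P p) [1..<Suc (length p)]"
    by (intro filter_cong) (auto simp: nth_append vertex_append)
  have right: "filter (?P (p @ q) \<circ> (\<lambda>x. x + length p)) [1..<Suc (length q)] =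
      filter (?P q) [1..<Suc (length q)]"
    \<comment> \<open>At abscissae beyond \<open>p\<close>, its contribution to the height is frozen
      at its end value 0.\<close>
    using assms vertex_beyond[OF le_add2, of p]
    by (intro filter_cong) (auto simp: nth_append vertex_append)
  show ?thesis
    unfolding returns_def split filter_append filter_map left right ..
qed

lemma map2_diff_shift:
  "map2 (\<lambda>x y. (y - x) div 2) (map (\<lambda>x. x + s) xs) (map (\<lambda>x. x + s) ys) =
   map2 (\<lambda>x y. (y - x) div 2) xs (ys :: nat list)"
  by (simp add: zip_map_map comp_def case_prod_unfold)

lemma returns_path_of_Cons:
  assumes "0 < m"
  shows "returns (path_of (m # c)) = 2 * m # map (\<lambda>x. x + 2 * m) (returns (path_of c))"
  using assms
  by (simp add: path_of_def returns_append[OF vertex_factor_end] returns_factor length_factor)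

lemma length_returns_path_of:
  "\<forall>a\<in>set c. 0 < a \<Longrightarrow> length (returns (path_of c)) = length c"
  by (induction c) (auto simp: returns_path_of_Cons, simp add: path_of_def returns_def)

lemma return_composition_path_of:
  "\<forall>a\<in>set c. 0 < a \<Longrightarrow> return_composition (path_of c) = c"
proof (induction c)
  case Nil
  then show ?case by (simp add: path_of_def returns_def return_composition_def)
next
  case (Cons m c)
  then show ?case
    \<comment> \<open>The pair \<open>(0, 2 * m)\<close> yields the part \<open>m\<close>. Shifting
      by \<open>2 * m\<close> turns the leading 0 for \<open>c\<close> into this first return, so
      the other differences are those of \<open>c\<close>.\<close>
    using map2_diff_shift[of "2 * m" "0 # returns (path_of c)" "returns (path_of c)"]
    by (simp add: return_composition_def returns_path_of_Cons)
qed

lemma length_path_of: "\<forall>a\<in>set c. 0 < a \<Longrightarrow> length (path_of c) = 2 * sum_list c"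
  by (induction c) (auto simp: path_of_def length_factor)

section \<open>Decomposition of bounded paths into factors\<close>

lemma strip_zigzag: "strip 1 (zigzag m @ D # q) \<longleftrightarrow> strip 0 q"
  by (induction m) auto

lemma strip_path_of: "strip 0 (path_of c)"
  by (induction c) (auto simp: path_of_def factor_def strip_zigzag)

text \<open>From height 1, a \<open>D\<close> closes the factor, while a \<open>U\<close> reaches
  the ceiling 2 and forces a \<open>D\<close> back to height 1. Two letters are removed at a time,
  hence the induction on length.\<close>

lemma strip_1_decompose:
  "strip 1 p \<Longrightarrow> \<exists>m q. p = zigzag m @ D # q"
proof (induction p rule: length_induct)
  case (1 p)
  show ?case
  proof (cases p)
    case (Cons s p')
    show ?thesis
    proof (cases s)
      case U
      then obtain p'' where p'': "p' = D # p''" "strip 1 p''"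
        using 1(2) Cons by (cases "(2 :: int, p')" rule: strip.cases) auto
      with 1(1) Cons obtain m q where "p'' = zigzag m @ D # q"
        by force
      then have "p = zigzag (Suc m) @ D # q"
        using Cons U p'' by simp
      then show ?thesis by blast
    next
      case D
      then have "p = zigzag 0 @ D # p'" using Cons by simp
      then show ?thesis by blast
    qed
  qed (use 1 in simp)
qed

lemma strip_0_eq_path_of:
  "strip 0 p \<Longrightarrow> \<exists>c. (\<forall>a\<in>set c. 0 < a) \<and> p = path_of c"
proof (induction p rule: length_induct)
  case (1 p)
  show ?case
  proof (cases "(0 :: int, p)" rule: strip.cases)
    case (1 h)
    then show ?thesis by (intro exI[of _ "[]"]) (simp add: path_of_def)
  next
    case (2 h p')
    then have "strip 1 p'" using "1.prems" by simp
    then obtain m q where p': "p' = zigzag m @ D # q"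
      using strip_1_decompose by blast
    then have "strip 0 q" using \<open>strip 1 p'\<close> strip_zigzag by simp
    with "1.IH" 2 p' obtain c where c: "\<forall>a\<in>set c. 0 < a" "q = path_of c"
      by force
    \<comment> \<open>The \<open>m\<close> inner peaks and the enclosing \<open>U\<close>,
      \<open>D\<close> make a factor of semilength \<open>Suc m\<close>.\<close>
    with 2 p' show ?thesis
      by (intro exI[of _ "Suc m # c"]) (simp add: path_of_def factor_def)
  next
    case (3 h p')
    then show ?thesis using "1.prems" by simp
  qed
qed

section \<open>Paths and compositions as inverse constructions\<close>

theorem theorem2p17:
  fixes n k :: nat
  assumes "n \<ge> 1" and "k \<ge> 1"
  shows "bij_betw return_composition
           {p \<in> dyck_paths n. height p \<le> 2 \<and> length (returns p) = k}
           (compositions n k)"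
proof (rule bij_betw_byWitness[where f' = path_of])
  let ?A = "{p \<in> dyck_paths n. height p \<le> 2 \<and> length (returns p) = k}"
  have ex: "\<exists>c\<in>compositions n k. p = path_of c" if "p \<in> ?A" for p
  proof -
    from that have len: "length p = 2 * n" and "strip 0 p" and k: "length (returns p) = k"
      using dyck_path_height_le_2_iff by auto
    then obtain c where "\<forall>a\<in>set c. 0 < a" "p = path_of c"
      using strip_0_eq_path_of by blast
    with len k show ?thesis
      by (auto simp: compositions_def length_path_of length_returns_path_of)
  qed
  have inv: "return_composition (path_of c) = c" if "c \<in> compositions n k" for c
    using that by (simp add: compositions_def return_composition_path_of)
  then show "\<forall>c\<in>compositions n k. return_composition (path_of c) = c" by blast
  \<comment> \<open>Writing \<open>p\<close> as \<open>path_of c\<close> by \<open>ex\<close>,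
    \<open>inv\<close> gives \<open>return_composition p = c\<close>; this settles both the second
    inverse law and the image inclusion.\<close>
  show "\<forall>p\<in>?A. path_of (return_composition p) = p" using ex inv by fastforce
  show "return_composition ` ?A \<subseteq> compositions n k" using ex inv by fastforce
  show "path_of ` compositions n k \<subseteq> ?A"
  proof clarify
    fix c assume "c \<in> compositions n k"
    then have c: "\<forall>a\<in>set c. 0 < a" "length c = k" "sum_list c = n"
      by (auto simp: compositions_def)
    then have "path_of c \<in> dyck_paths n \<and> height (path_of c) \<le> 2"
      unfolding dyck_path_height_le_2_iff by (simp add: length_path_of strip_path_of)
    with c show "path_of c \<in> dyck_paths n \<and> height (path_of c) \<le> 2 \<and>
        length (returns (path_of c)) = k"
      by (simp add: length_returns_path_of)
  qed
qed

end
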